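(* Let $-1<B<A\le 1$, let $\mu=(\cosh 1-1)/(1-\cos 1)$, and let $B_0\in(-1,0)$ be the nonzero root of the equation $(1+B)(1-B)^\mu=1$. Let $\eta\in\mathbb{R}$, $\eta\neq 0$. If $p$ is an analytic function in $\mathbb{D}$ with $p(0)=1$ satisfying $$1+\eta zp'(z)\prec\frac{1+Az}{1+Bz},$$ then $p(z)\prec\cosh\sqrt z$, provided $\eta$ satisfies the following sharp inequalities: $$\begin{cases}\eta B(\cosh 1-1)\le(A-B)\log(1+B) & \text{if } -1<B\le B_0,\\ \eta B(\cos 1-1)\ge(A-B)\log(1-B) & \text{if } B_0<B<0,\\ \eta B(\cos 1-1)\le(A-B)\log(1-B) & \text{if } 0<B<1,\\ 2\eta\ge A\csc^2(1/2) & \text{if } B=0.\end{cases}$$ (Sharp means that in each case the resulting lower bound on $\eta$ cannot be replaced by a smaller number.)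
   Context: $\mathbb{D}=\{z\in\mathbb{C}:|z|<1\}$. For analytic functions $f,g$ on $\mathbb{D}$, $f\prec g$ means that $f(z)=g(w(z))$ for some analytic $w:\mathbb{D}\to\mathbb{D}$ with $w(0)=0$. The function $\cosh\sqrt z$ denotes the analytic function $\sum_{n=0}^\infty z^n/(2n)!$. *)

theory Defs
  imports "HOL-Complex_Analysis.Complex_Analysis"
begin

definition subordinate :: "(complex \<Rightarrow> complex) \<Rightarrow> (complex \<Rightarrow> complex) \<Rightarrow> bool"
    (infix \<open>\<prec>\<^sub>D\<close> 50) where
  "f \<prec>\<^sub>D g \<longleftrightarrow>
     (\<exists>w. w holomorphic_on ball 0 1 \<and> w ` ball 0 1 \<subseteq> ball 0 1 \<and> w 0 = 0 \<and>
          (\<forall>z\<in>ball 0 1. f z = g (w z)))"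

text \<open>The entire function usually written \<open>cosh (sqrt z)\<close>; no branch of the square root is involved.\<close>

definition coshsqrt :: "complex \<Rightarrow> complex" where
  "coshsqrt z = (\<Sum>n. z ^ n / fact (2 * n))"

definition subordination_implication :: "real \<Rightarrow> real \<Rightarrow> real \<Rightarrow> bool" where
  "subordination_implication A B \<eta> \<longleftrightarrow>
     (\<forall>p. p holomorphic_on ball 0 1 \<longrightarrow> p 0 = 1 \<longrightarrow>
        (\<lambda>z. 1 + of_real \<eta> * z * deriv p z) \<prec>\<^sub>D
          (\<lambda>z. (1 + of_real A * z) / (1 + of_real B * z)) \<longrightarrow>
        p \<prec>\<^sub>D coshsqrt)"

text \<open>The four cases are exhaustive and mutually exclusive for \<open>-1 < B < 1\<close> and \<open>-1 < B\<^sub>0 < 0\<close>;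
  \<open>1 / sin (1/2)\<close> is the cosecant of \<open>1/2\<close>.\<close>

definition eta_condition :: "real \<Rightarrow> real \<Rightarrow> real \<Rightarrow> real \<Rightarrow> bool" where
  "eta_condition B\<^sub>0 A B \<eta> \<longleftrightarrow>
     (-1 < B \<and> B \<le> B\<^sub>0 \<longrightarrow> \<eta> * B * (cosh 1 - 1) \<le> (A - B) * ln (1 + B)) \<and>
     (B\<^sub>0 < B \<and> B < 0 \<longrightarrow> \<eta> * B * (cos 1 - 1) \<ge> (A - B) * ln (1 - B)) \<and>
     (0 < B \<and> B < 1 \<longrightarrow> \<eta> * B * (cos 1 - 1) \<le> (A - B) * ln (1 - B)) \<and>
     (B = 0 \<longrightarrow> 2 * \<eta> \<ge> A * (1 / sin (1/2))\<^sup>2)"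

end

theory Submission
  imports Defs
begin

text \<open>
  Write \<open>c = (A - B) / \<eta>\<close> and \<open>L z = Ln (1 + B z) / B\<close> (with \<open>L z = z\<close> for \<open>B = 0\<close>). Equality in the
  hypothesis is attained by \<open>q = 1 + c L\<close>. An admissible \<open>p\<close> has the form \<open>p = 1 + c L(v)\<close> with
  \<open>v\<close> obtained by exponentiating \<open>p\<close>, and Jack's lemma shows that \<open>v\<close> maps the unit disc into
  itself. Since the inequality \<open>cosh \<bar>u\<bar> cos (Im u) \<le> cosh (Re u)\<close> puts \<open>Ln (1 + \<zeta>)\<close> for \<open>\<bar>\<zeta>\<bar> < b\<close> into the
  disc with diameter from \<open>ln (1 - b)\<close> to \<open>ln (1 + b)\<close>, the values of \<open>p\<close> lie in the disc with
  diameter from \<open>q(-1)\<close> to \<open>q(1)\<close>. The condition on \<open>\<eta>\<close> says exactly that this diameter is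
  contained in the interval from \<open>cos 1\<close> to \<open>cosh 1\<close>: concavity of \<open>ln (1 + B) + \<mu> ln (1 - B)\<close>, which
  vanishes at \<open>0\<close> and \<open>B\<^sub>0\<close>, decides which of the two end points is critical. Finally, the whole disc with
  diameter from \<open>cos 1\<close> to \<open>cosh 1\<close> lies in the image of the unit disc under \<open>cosh (sqrt z)\<close>.
  For smaller \<open>\<eta> > 0\<close>, \<open>q\<close> attains \<open>cos 1\<close> or \<open>cosh 1\<close> inside the unit disc, whereas \<open>cosh (sqrt z)\<close>, being
  injective on the closed disc, takes these values only at the boundary points \<open>-1\<close> and \<open>1\<close>.
\<close>

section \<open>The function \<open>cosh (sqrt z)\<close>\<close>

lemma summable_coshsqrt: "summable (\<lambda>n. z ^ n / fact (2 * n) :: complex)"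
proof (rule summable_comparison_test)
  show "summable (\<lambda>n. norm z ^ n /\<^sub>R fact n)"
    by (rule sums_summable[OF exp_converges])
  have "norm (z ^ n / fact (2 * n)) \<le> norm z ^ n /\<^sub>R fact n" for n
    by (simp add: norm_mult norm_inverse norm_power divide_inverse mult.commute[of "inverse _"]
        mult_left_mono le_imp_inverse_le fact_mono)
  then show "\<exists>N. \<forall>n\<ge>N. norm (z ^ n / fact (2 * n)) \<le> norm z ^ n /\<^sub>R fact n"
    by blast
qed

lemma coshsqrt_sums: "(\<lambda>n. z ^ n / fact (2 * n)) sums coshsqrt z"
  unfolding coshsqrt_def by (rule summable_sums[OF summable_coshsqrt])

lemma cosh_sums_even:
  fixes s :: "'a :: {real_normed_field, banach}"
  shows "(\<lambda>n. s ^ (2 * n) /\<^sub>R fact (2 * n)) sums cosh s"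
proof -
  have "strict_mono (\<lambda>n::nat. 2 * n)"
    by (simp add: strict_mono_def)
  moreover have "(if even n then s ^ n /\<^sub>R fact n else 0) = 0" if "n \<notin> range (\<lambda>n::nat. 2 * n)" for n
    using that by (auto elim!: evenE)
  ultimately have "(\<lambda>n. if even (2 * n) then s ^ (2 * n) /\<^sub>R fact (2 * n) else 0) sums cosh s"
    using cosh_converges[of s] by (subst sums_mono_reindex[where g = "\<lambda>n. 2 * n"]) auto
  then show ?thesis by simp
qed

lemma coshsqrt_square: "coshsqrt (s\<^sup>2) = cosh s"
proof -
  have "(\<lambda>n. s ^ (2 * n) /\<^sub>R fact (2 * n)) = (\<lambda>n. (s\<^sup>2) ^ n / fact (2 * n))"
    by (simp add: fun_eq_iff scaleR_conv_of_real divide_inverse mult.commute[of "inverse _"] flip: power_mult)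
  then show ?thesis
    using cosh_sums_even[of s] coshsqrt_sums[of "s\<^sup>2"] by (simp add: sums_unique2)
qed

lemma coshsqrt_0 [simp]: "coshsqrt 0 = 1"
  using coshsqrt_square[of 0] by simp

lemma coshsqrt_1: "coshsqrt 1 = complex_of_real (cosh 1)"
  using coshsqrt_square[of 1] by (simp add: cosh_field_def flip: exp_of_real)

lemma coshsqrt_minus_1: "coshsqrt (-1) = complex_of_real (cos 1)"
proof -
  have "coshsqrt (-1) = cos (complex_of_real (-1))"
    using coshsqrt_square[of \<i>] by (simp add: cosh_conv_cos)
  then show ?thesis by (simp only: cos_of_real) simp
qed

lemma coshsqrt_holomorphic: "coshsqrt holomorphic_on S"
proof -
  have "((\<lambda>z. \<Sum>n. 1 / fact (2 * n) * z ^ n) has_field_derivative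
      (\<Sum>n. diffs (\<lambda>n. 1 / fact (2 * n)) n * z ^ n)) (at z)" for z :: complex
    by (rule termdiffs_strong_converges_everywhere) (use summable_coshsqrt in simp)
  then have "\<exists>f'. (coshsqrt has_field_derivative f') (at z)" for z
    unfolding coshsqrt_def[abs_def] by (auto simp: field_simps)
  then show ?thesis
    by (meson DERIV_subset field_differentiable_def holomorphic_on_def subset_UNIV)
qed

text \<open>With \<open>w = - s\<^sup>2\<close> and \<open>z = - t\<^sup>2\<close>, equal values
  mean \<open>cos s = cos t\<close>, so \<open>s\<close> is \<open>t\<close> or \<open>- t\<close>
  up to \<open>2 * n * pi\<close>. Since \<open>s\<close> and \<open>t\<close> have modulus at most
  1, this period has modulus at most 2, which forces \<open>n = 0\<close>.\<close>

lemma coshsqrt_inj: "inj_on coshsqrt (cball 0 1)"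
proof (rule inj_onI)
  fix w z :: complex
  assume wz: "w \<in> cball 0 1" "z \<in> cball 0 1" and eq: "coshsqrt w = coshsqrt z"
  define s t where "s = \<i> * csqrt w" and "t = \<i> * csqrt z"
  have sq: "s\<^sup>2 = - w" "t\<^sup>2 = - z"
    by (simp_all add: s_def t_def power_mult_distrib)
  have "cmod s ^ 2 \<le> 1\<^sup>2" "cmod t ^ 2 \<le> 1\<^sup>2"
    using wz by (simp_all flip: norm_power add: sq)
  then have st: "cmod s \<le> 1" "cmod t \<le> 1"
    using power2_le_imp_le[OF _ zero_le_one] by blast+
  have "cos s = cos t"
    using eq coshsqrt_square[of "csqrt w"] coshsqrt_square[of "csqrt z"]
    by (simp add: s_def t_def cosh_conv_cos)
  then obtain n where n: "n \<in> \<int>" "s = t + of_real (2 * n * pi) \<or> s = - t + of_real (2 * n * pi)"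
    using complex_cos_eq by blast
  then have "of_real (2 * n * pi) = s - t \<or> of_real (2 * n * pi) = s + t"
    by (auto simp: algebra_simps)
  then have "cmod (of_real (2 * n * pi)) \<le> cmod s + cmod t"
    by (elim disjE) (simp_all only: norm_triangle_ineq norm_triangle_ineq4)
  then have "2 * \<bar>n\<bar> * pi \<le> 2"
    using st by (simp add: norm_mult)
  moreover have "\<bar>n\<bar> * 3 \<le> \<bar>n\<bar> * pi"
    using pi_gt3 by (intro mult_left_mono) auto
  ultimately have "\<bar>n\<bar> < 1"
    by linarith
  then have "n = 0"
    using n(1) Ints_nonzero_abs_less1 by blast
  then have "s\<^sup>2 = t\<^sup>2"
    using n by auto
  then show "w = z" using sq by simp
qed

text \<open>The series of \<open>cosh 1\<close> and \<open>cos 1\<close> add up to one with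
  nonnegative terms whose first is 2. The second bound says that the disc with diameter from
  \<open>cos 1\<close> to \<open>cosh 1\<close> has radius at most 1.\<close>

lemma cosh_cos_1_bounds: "2 \<le> cosh 1 + cos (1::real)" "cosh 1 - cos (1::real) \<le> 2"
  "1 < cosh (1::real)" "cos (1::real) < 1"
proof -
  have "(\<lambda>n. 1 ^ n / fact (2 * n) + (- 1) ^ n / fact (2 * n)) sums complex_of_real (cosh 1 + cos 1)"
    unfolding of_real_add coshsqrt_1[symmetric] coshsqrt_minus_1[symmetric]
    by (intro sums_add coshsqrt_sums)
  then have "(\<lambda>n. Re (1 ^ n / fact (2 * n) + (- 1) ^ n / fact (2 * n))) sums (cosh 1 + cos 1)"
    using sums_Re by fastforce
  moreover have "Re (1 ^ n / fact (2 * n) + (- 1) ^ n / fact (2 * n)) = (1 + (- 1) ^ n) / fact (2 * n)" for n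
    using Re_divide_of_real[of _ "fact (2 * n)"] by (cases "even n") (simp_all add: of_real_fact)
  ultimately have "(\<lambda>n. (1 + (- 1) ^ n) / fact (2 * n)) sums (cosh 1 + cos (1::real))"
    by simp
  then have "(\<Sum>n\<in>{0}. (1 + (- 1) ^ n) / fact (2 * n)) \<le> cosh 1 + cos (1::real)"
    by (intro sum_le_suminf[THEN order_trans])
      (auto simp: sums_iff intro!: divide_nonneg_nonneg, smt (verit) minus_one_power_iff)
  then show "2 \<le> cosh 1 + cos (1::real)" by simp
  have "0 < cos (1::real)"
    using pi_gt3 by (intro cos_gt_zero) auto
  \<comment> \<open>This is the mean of \<open>exp 1 \<le> 3\<close> and
    \<open>exp (-1) \<le> 1\<close>.\<close>
  moreover have "cosh (1::real) \<le> 2"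
    using exp_le exp_le_one_iff[of "-1::real"] by (simp add: cosh_field_def del: exp_le_one_iff)
  ultimately show "cosh 1 - cos (1::real) \<le> 2" by simp
  show "cos (1::real) < 1"
    using cos_monotone_0_pi[of 0 1] pi_gt3 by simp
  show "1 < cosh (1::real)"
    by (metis cosh_real_nonneg_less_iff cosh_0 less_eq_real_def zero_less_one order_refl)
qed

section \<open>The image of the unit circle\<close>

text \<open>For \<open>z\<close> at angle \<open>t\<close> this bounds \<open>sin (n * t)\<close> by
  \<open>n\<close> times \<open>sin t\<close> in absolute value, through the addition
  formula.\<close>

lemma abs_Im_power_le:
  assumes "cmod z = 1"
  shows "\<bar>Im (z ^ n)\<bar> \<le> n * \<bar>Im z\<bar>"
proof (induction n)
  case (Suc n)
  have "\<bar>Im (z ^ Suc n)\<bar> \<le> \<bar>Re z\<bar> * \<bar>Im (z ^ n)\<bar> + \<bar>Im z\<bar> * \<bar>Re (z ^ n)\<bar>"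
    using abs_triangle_ineq[of "Re z * Im (z ^ n)" "Im z * Re (z ^ n)"] by (simp add: abs_mult)
  also have "\<dots> \<le> 1 * \<bar>Im (z ^ n)\<bar> + \<bar>Im z\<bar> * 1"
    using abs_Re_le_cmod[of z] abs_Re_le_cmod[of "z ^ n"] assms
    by (intro add_mono mult_left_mono mult_right_mono) (auto simp: norm_power)
  finally show ?case
    using Suc by (simp add: algebra_simps)
qed simp

text \<open>Up to the unimodular factor \<open>cnj z\<close>, the error of interpolating the \<open>n\<close>-th power linearly between
  \<open>-1\<close> and \<open>1\<close>. On the unit circle its real part is of order \<open>(Im z)\<^sup>2\<close>, one order smaller than its
  imaginary part; this is what makes the distance estimate below work near \<open>z = 1\<close> and \<open>z = -1\<close>.\<close>

definition interp_err :: "complex \<Rightarrow> nat \<Rightarrow> complex" where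
  "interp_err z n = cnj z * (z ^ n - ((1 + (-1) ^ n) / 2 + z * (1 - (-1) ^ n) / 2))"

text \<open>The interpolant depends only on the parity of \<open>n\<close>, so it cancels between
  \<open>n\<close> and \<open>n + 2\<close>; the rest simplifies by
  \<open>cnj z * z = 1\<close>.\<close>

lemma interp_err_rec:
  assumes "cmod z = 1"
  shows "interp_err z (Suc (Suc n)) = 2 * \<i> * of_real (Im z) * z ^ n + interp_err z n"
proof -
  have "cnj z * z = 1"
    using complex_norm_square[of z] assms by (simp add: mult.commute)
  then have "cnj z * (z ^ Suc (Suc n) - z ^ n) = (z - cnj z) * z ^ n"
    by (simp add: algebra_simps)
  then show ?thesis
    by (simp add: interp_err_def complex_diff_cnj algebra_simps)
qed

lemma interp_err_0 [simp]: "interp_err z 0 = 0"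
  and interp_err_1 [simp]: "interp_err z (Suc 0) = 0"
  by (simp_all add: interp_err_def)

text \<open>One step of the recursion changes the imaginary part by at most
  \<open>2 * |Im z|\<close> and the real part by \<open>-2 * Im z * Im (z ^ n)\<close>, hence by at
  most \<open>2 * n * (Im z)\<^sup>2\<close>; and \<open>2 * n\<close> is the growth of
  \<open>(n - 1)\<^sup>2 / 2\<close> from \<open>n\<close> to \<open>n + 2\<close>.\<close>

lemma interp_err_bounds:
  assumes "cmod z = 1"
  shows "\<bar>Im (interp_err z n)\<bar> \<le> n * \<bar>Im z\<bar>"
    and "\<bar>Re (interp_err z n)\<bar> \<le> (real n - 1)\<^sup>2 / 2 * (Im z)\<^sup>2"
proof (induction n rule: induct_nat_012)
  case (ge2 n)
  {
    case 1
    have "\<bar>Re (z ^ n)\<bar> \<le> 1"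
      using abs_Re_le_cmod[of "z ^ n"] assms by (simp add: norm_power)
    then have "\<bar>Im z\<bar> * \<bar>Re (z ^ n)\<bar> \<le> \<bar>Im z\<bar> * 1"
      by (intro mult_left_mono) auto
    then show ?case
      using ge2(1) interp_err_rec[OF assms, of n]
        abs_triangle_ineq[of "2 * (Im z * Re (z ^ n))" "Im (interp_err z n)"]
      by (simp add: abs_mult algebra_simps)
  next
    case 2
    have "\<bar>Im z\<bar> * \<bar>Im (z ^ n)\<bar> \<le> \<bar>Im z\<bar> * (n * \<bar>Im z\<bar>)"
      by (intro mult_left_mono abs_Im_power_le assms) auto
    also have "\<dots> = n * (Im z)\<^sup>2"
      by (simp add: power2_eq_square)
    finally show ?case
      using ge2(2) interp_err_rec[OF assms, of n]
        abs_triangle_ineq[of "- 2 * (Im z * Im (z ^ n))" "Re (interp_err z n)"]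
      by (simp add: abs_mult algebra_simps power2_eq_square)
  }
qed auto

text \<open>The start is \<open>720 = 6!\<close>, and each step adds two factors of at least 7 and
  8. The offset 3 matches the tail of the error series estimated below.\<close>

lemma fact_ge_geometric: "720 * 56 ^ n \<le> (fact (2 * (n + 3)) :: real)"
proof (induction n)
  case (Suc n)
  have "fact (2 * (Suc n + 3)) = (2 * real n + 8) * (2 * real n + 7) * fact (2 * (n + 3))"
    by (simp add: algebra_simps fact_reduce)
  also have "\<dots> \<ge> (8 * 7) * (720 * 56 ^ n)"
    by (intro mult_mono Suc) auto
  finally show ?case by simp
qed (simp add: fact_numeral)

lemma real_add_le_mult_power: "real n + k \<le> k * (1 + 1 / k) ^ n" if "k > 0" for k :: real
  using Bernoulli_inequality[of "1 / k" n] that by (simp add: field_simps)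

text \<open>Multiplying the deviation from the centre by \<open>cnj z\<close> keeps its modulus and
  turns its linear interpolation into the radius \<open>R\<close>, so \<open>N - R\<close> is the
  sum of the errors. Now \<open>Re N\<close> falls short of \<open>R\<close> by at most order
  \<open>y\<^sup>2\<close>, while \<open>Im N\<close> is at least of order \<open>y\<close>; its
  square makes up for the loss.\<close>

lemma coshsqrt_unit_circle:
  assumes z: "cmod z = 1"
  shows "cosh 1 - cos 1 \<le> 2 * cmod (coshsqrt z - of_real ((cosh 1 + cos 1) / 2))"
proof -
  define y where "y = \<bar>Im z\<bar>"
  define R where "R = (cosh 1 - cos (1::real)) / 2"
  define g where "g n = interp_err z n / fact (2 * n)" for n
  define N where "N = cnj z * (coshsqrt z - of_real ((cosh 1 + cos 1) / 2))"
  have zz: "cnj z * z = 1"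
    using complex_norm_square[of z] z by (simp add: mult.commute)
  have "(\<lambda>n. cnj z * (z ^ n / fact (2 * n) -
      ((1 ^ n / fact (2 * n) + (-1) ^ n / fact (2 * n)) / 2
      + z * (1 ^ n / fact (2 * n) - (-1) ^ n / fact (2 * n)) / 2))) sums
      (cnj z * (coshsqrt z - ((coshsqrt 1 + coshsqrt (-1)) / 2
      + z * (coshsqrt 1 - coshsqrt (-1)) / 2)))"
    by (intro sums_mult sums_diff sums_add sums_divide coshsqrt_sums)
  also have "(\<lambda>n. cnj z * (z ^ n / fact (2 * n) -
      ((1 ^ n / fact (2 * n) + (-1) ^ n / fact (2 * n)) / 2
      + z * (1 ^ n / fact (2 * n) - (-1) ^ n / fact (2 * n)) / 2))) = g"
    by (simp add: fun_eq_iff g_def interp_err_def field_simps)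
  also have "cnj z * (coshsqrt z - ((coshsqrt 1 + coshsqrt (-1)) / 2
      + z * (coshsqrt 1 - coshsqrt (-1)) / 2)) = N - of_real R"
  proof -
    have "cnj z * (a - (b + z * c / 2)) = cnj z * (a - b) - cnj z * z * (c / 2)" for a b c
      by (simp add: algebra_simps)
    then show ?thesis
      by (simp add: zz N_def R_def coshsqrt_1 coshsqrt_minus_1)
  qed
  finally have "g sums (N - of_real R)" .
  \<comment> \<open>Errors 0 and 1 vanish, and error 2 contributes the dominant term
    \<open>\<i> * Im z / 12\<close>, which is kept apart from the tail.\<close>
  then have sums: "(\<lambda>n. g (n + 3)) sums (N - of_real R - g 2)"
    by (subst sums_iff_shift) (simp add: eval_nat_numeral g_def)
  have g: "Re (g n) = Re (interp_err z n) / fact (2 * n)"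
    "Im (g n) = Im (interp_err z n) / fact (2 * n)" for n
    using Re_divide_of_real[of _ "fact (2 * n)"] Im_divide_of_real[of _ "fact (2 * n)"]
    by (simp_all add: g_def)
  have g2: "Re (g 2) = 0" "Im (g 2) = Im z / 12"
    using interp_err_rec[OF z, of 0] by (simp_all add: g eval_nat_numeral)

  have Re_sums: "(\<lambda>n. Re (g (n + 3))) sums (Re N - R)"
    using sums_Re[OF sums] g2 by simp
  \<comment> \<open>The constants are \<open>(2\<^sup>2 / 2) / 720\<close> and
    \<open>(3 / 2)\<^sup>2 / 56\<close>, with Bernoulli's inequality absorbing
    \<open>n + 2\<close>.\<close>
  have "norm (Re (g (n + 3))) \<le> y\<^sup>2 / 360 * (9 / 224) ^ n" for n
  proof -
    have "\<bar>Re (interp_err z (n + 3))\<bar> \<le> (real n + 2)\<^sup>2 / 2 * y\<^sup>2"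
      using interp_err_bounds(2)[OF z, of "n + 3"] by (simp add: y_def add.commute)
    moreover have "norm (Re (g (n + 3))) = \<bar>Re (interp_err z (n + 3))\<bar> / fact (2 * (n + 3))"
      by (simp add: g)
    ultimately have "norm (Re (g (n + 3))) \<le> (real n + 2)\<^sup>2 / 2 * y\<^sup>2 / fact (2 * (n + 3))"
      by (simp only: divide_right_mono fact_ge_zero)
    also have "\<dots> \<le> (2 * (1 + 1 / 2) ^ n)\<^sup>2 / 2 * y\<^sup>2 / (720 * 56 ^ n)"
      using real_add_le_mult_power[of 2 n]
      by (intro frac_le mult_right_mono divide_right_mono power_mono fact_ge_geometric) auto
    also have "\<dots> = y\<^sup>2 / 360 * (((1 + 1 / 2) ^ n)\<^sup>2 / 56 ^ n)"
      by (simp add: power_mult_distrib)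
    also have "((1 + 1 / 2) ^ n)\<^sup>2 / 56 ^ n = ((1 + 1 / 2)\<^sup>2 / 56 :: real) ^ n"
      by (simp only: power_divide mult.commute flip: power_mult)
    finally show ?thesis by (simp add: power2_eq_square)
  qed
  moreover have "(\<lambda>n. y\<^sup>2 / 360 * (9 / 224) ^ n) sums (y\<^sup>2 / 360 * (1 / (1 - 9 / 224)))"
    by (intro sums_mult geometric_sums) auto
  ultimately have Re_N: "\<bar>Re N - R\<bar> \<le> y\<^sup>2 / 360 * (1 / (1 - 9 / 224))"
    using norm_sums_le[OF Re_sums] by (metis real_norm_def)

  have Im_sums: "(\<lambda>n. Im (g (n + 3))) sums (Im N - Im z / 12)"
    using sums_Im[OF sums] g2 by simp
  have "norm (Im (g (n + 3))) \<le> y / 240 * (1 / 42) ^ n" for n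
  proof -
    have "norm (Im (g (n + 3))) \<le> (real n + 3) * y / fact (2 * (n + 3))"
      using interp_err_bounds(1)[OF z, of "n + 3"]
      by (simp add: g y_def divide_right_mono add.commute del: fact_Suc mult_Suc_right)
    also have "\<dots> \<le> (3 * (1 + 1 / 3) ^ n) * y / (720 * 56 ^ n)"
      using real_add_le_mult_power[of 3 n]
      by (intro frac_le mult_right_mono fact_ge_geometric) (auto simp: y_def)
    also have "\<dots> = y / 240 * ((1 + 1 / 3) ^ n / 56 ^ n)"
      by simp
    also have "(1 + 1 / 3) ^ n / 56 ^ n = ((1 + 1 / 3) / 56 :: real) ^ n"
      by (simp only: power_divide)
    finally show ?thesis by simp
  qed
  moreover have "(\<lambda>n. y / 240 * (1 / 42) ^ n) sums (y / 240 * (1 / (1 - 1 / 42)))"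
    by (intro sums_mult geometric_sums) auto
  ultimately have "\<bar>Im N - Im z / 12\<bar> \<le> y / 240 * (1 / (1 - 1 / 42))"
    using norm_sums_le[OF Im_sums] by (metis real_norm_def)
  moreover have "y / 12 \<le> \<bar>Im N\<bar> + \<bar>Im N - Im z / 12\<bar>"
    using abs_triangle_ineq4[of "Im N" "Im N - Im z / 12"] by (simp add: y_def)
  \<comment> \<open>The exact factor is \<open>1 / 12 - 7 / 1640\<close>; \<open>13 / 168\<close>
    rounds it down.\<close>
  moreover have "s * (13 / 168) \<le> i"
    if "d \<le> s / 240 * (1 / (1 - 1 / 42))" "s / 12 \<le> i + d" "0 \<le> s" for s i d :: real
    using that by simp
  moreover have "0 \<le> y" by (simp add: y_def)
  ultimately have "y * (13 / 168) \<le> \<bar>Im N\<bar>" by blast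
  then have "(y * (13 / 168))\<^sup>2 \<le> (Im N)\<^sup>2"
    by (subst power2_abs[of "Im N", symmetric], intro power_mono) (auto simp: y_def)
  then have Im_N: "y\<^sup>2 * (169 / 28224) \<le> (Im N)\<^sup>2"
    by (simp add: power_mult_distrib power2_eq_square)
  have R: "0 \<le> R" "R \<le> 1"
    using cosh_cos_1_bounds by (simp_all add: R_def)
  define K where "K = y\<^sup>2 / 360 * (1 / (1 - 9 / 224))"
  have "R * (R - Re N) \<le> R * K"
    using R Re_N unfolding K_def[symmetric] by (intro mult_left_mono) auto
  also have "\<dots> \<le> 1 * K"
    using R by (intro mult_right_mono) (auto simp: K_def)
  finally have "R * (R - Re N) \<le> 28 / 9675 * y\<^sup>2"
    by (simp add: K_def)
  moreover have "(Re N)\<^sup>2 = R\<^sup>2 - 2 * (R * (R - Re N)) + (R - Re N)\<^sup>2"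
    by algebra
  moreover have "0 \<le> (R - Re N)\<^sup>2" "0 \<le> y\<^sup>2"
    by simp_all
  \<comment> \<open>The numerical point is that \<open>2 * 28 / 9675\<close> is below
    \<open>169 / 28224\<close>.\<close>
  ultimately have "R\<^sup>2 \<le> (Re N)\<^sup>2 + (Im N)\<^sup>2"
    using Im_N by linarith
  then have "R \<le> cmod N"
    unfolding cmod_power2[symmetric] by (rule power2_le_imp_le) simp
  then show ?thesis
    using z by (simp add: R_def N_def norm_mult)
qed

text \<open>Both sets contain \<open>1 = coshsqrt 0\<close>, so if the connected disc left the image
  it would meet the frontier of the image. By the open mapping theorem and compactness that frontier
  lies in the image of the unit circle, which avoids the open disc.\<close>

lemma disc_subset_coshsqrt_image:
  "ball (of_real ((cosh 1 + cos 1) / 2)) ((cosh 1 - cos 1) / 2) \<subseteq> coshsqrt ` ball 0 1" (is "?D \<subseteq> ?T")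
proof (rule ccontr)
  assume "\<not> ?D \<subseteq> ?T"
  moreover have "1 \<in> ?T"
    by (rule image_eqI[of _ _ 0]) auto
  moreover have "1 \<in> ?D"
  proof -
    have "dist (of_real ((cosh 1 + cos 1) / 2)) (1::complex) = \<bar>(cosh 1 + cos 1) / 2 - 1\<bar>"
      unfolding dist_norm by (metis norm_of_real of_real_1 of_real_diff)
    then show ?thesis
      using cosh_cos_1_bounds unfolding mem_ball by argo
  qed
  ultimately have "?D \<inter> frontier ?T \<noteq> {}"
    by (intro connected_Int_frontier connected_ball) blast+
  then obtain x where x: "x \<in> ?D" "x \<in> frontier ?T" by blast
  have "inj_on coshsqrt (ball 0 1)"
    by (rule inj_on_subset[OF coshsqrt_inj]) auto
  then have "open ?T"
    by (intro open_mapping_thm3 coshsqrt_holomorphic) auto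
  moreover have "closure ?T \<subseteq> coshsqrt ` cball 0 1"
    by (intro closure_minimal compact_imp_closed compact_continuous_image
        holomorphic_on_imp_continuous_on coshsqrt_holomorphic image_mono) auto
  ultimately have "x \<in> coshsqrt ` cball 0 1" "x \<notin> ?T"
    using x(2) by (auto simp: frontier_def interior_open)
  then obtain z where z: "x = coshsqrt z" "z \<in> cball 0 1" "z \<notin> ball 0 1" by blast
  then have "cmod z = 1" by simp
  from coshsqrt_unit_circle[OF this] x(1) z(1) show False
    by (simp add: dist_norm norm_minus_commute)
qed

section \<open>Subordination to a univalent function\<close>

lemma subordinateE:
  assumes "f \<prec>\<^sub>D g"
  obtains w where "\<And>z. cmod z < 1 \<Longrightarrow> cmod (w z) < 1" "\<And>z. cmod z < 1 \<Longrightarrow> f z = g (w z)"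
proof -
  from assms obtain w where "w ` ball 0 1 \<subseteq> ball 0 1" "\<forall>z\<in>ball 0 1. f z = g (w z)"
    unfolding subordinate_def by blast
  then show ?thesis
    by (intro that[of w]) (auto simp: image_subset_iff)
qed

text \<open>Injectivity provides a holomorphic inverse on the image; composed with \<open>p\<close>
  it is the required self-map of the disc.\<close>

lemma subordinate_coshsqrtI:
  assumes "p holomorphic_on ball 0 1" "p 0 = 1" "p ` ball 0 1 \<subseteq> coshsqrt ` ball 0 1"
  shows "p \<prec>\<^sub>D coshsqrt"
proof -
  have "inj_on coshsqrt (ball 0 1)"
    by (rule inj_on_subset[OF coshsqrt_inj]) auto
  from holomorphic_has_inverse[OF coshsqrt_holomorphic open_ball this]
  obtain g where g: "g holomorphic_on coshsqrt ` ball 0 1" "\<And>z. z \<in> ball 0 1 \<Longrightarrow> g (coshsqrt z) = z"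
    by metis
  show ?thesis
    unfolding subordinate_def
  proof (intro exI[of _ "g \<circ> p"] conjI ballI)
    show "g \<circ> p holomorphic_on ball 0 1"
      using assms g(1) by (intro holomorphic_on_compose_gen)
    show "(g \<circ> p) ` ball 0 1 \<subseteq> ball 0 1"
      using assms(3) g(2) by fastforce
    show "(g \<circ> p) 0 = 0"
      using assms(2) g(2)[of 0] by simp
    show "p z = coshsqrt ((g \<circ> p) z)" if "z \<in> ball 0 1" for z
      using assms(3) g(2) that by fastforce
  qed
qed

section \<open>The logarithm on discs\<close>

text \<open>The sign of the derivative comes from \<open>sinh x \<le> x * cosh x\<close>, which
  holds because the difference has derivative \<open>x * sinh x\<close>.\<close>

lemma cosh_exp_antimono:
  fixes t r :: real
  assumes "0 \<le> t" "t \<le> r"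
  shows "cosh r * exp (- r\<^sup>2 / 2) \<le> cosh t * exp (- t\<^sup>2 / 2)"
proof (rule DERIV_nonpos_imp_nonincreasing[OF assms(2)])
  fix x assume "t \<le> x" "x \<le> r"
  then have "0 \<le> x" using assms by simp
  have "0 * cosh 0 - sinh 0 \<le> x * cosh x - sinh x"
  proof (rule DERIV_nonneg_imp_nondecreasing[OF \<open>0 \<le> x\<close>])
    fix u :: real assume "0 \<le> u" "u \<le> x"
    then show "\<exists>y. ((\<lambda>x. x * cosh x - sinh x) has_real_derivative y) (at u) \<and> 0 \<le> y"
      by (intro exI[of _ "u * sinh u"]) (auto intro!: derivative_eq_intros)
  qed
  then have "(sinh x - x * cosh x) * exp (- x\<^sup>2 / 2) \<le> 0"
    by (intro mult_nonpos_nonneg) auto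
  moreover have "((\<lambda>x. cosh x * exp (- x\<^sup>2 / 2)) has_real_derivative
      (sinh x - x * cosh x) * exp (- x\<^sup>2 / 2)) (at x)"
    by (auto intro!: derivative_eq_intros simp: algebra_simps)
  ultimately show "\<exists>y. ((\<lambda>x. cosh x * exp (- x\<^sup>2 / 2)) has_real_derivative y) (at x) \<and> y \<le> 0"
    by blast
qed

lemma cos_le_exp:
  fixes y :: real
  assumes "\<bar>y\<bar> \<le> pi / 2"
  shows "cos y \<le> exp (- y\<^sup>2 / 2)"
proof -
  define a where "a = \<bar>y\<bar>"
  have a: "0 \<le> a" "a \<le> pi / 2" using assms by (simp_all add: a_def)
  have "cos a * exp (a\<^sup>2 / 2) \<le> cos 0 * exp (0\<^sup>2 / 2)"
  proof (rule DERIV_nonpos_imp_nonincreasing[OF a(1)])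
    fix x assume x: "0 \<le> x" "x \<le> a"
    have "0 * cos 0 - sin 0 \<ge> x * cos x - sin x"
    proof (rule DERIV_nonpos_imp_nonincreasing[OF x(1)])
      fix u :: real assume "0 \<le> u" "u \<le> x"
      moreover from this have "0 \<le> sin u" using x a by (intro sin_ge_zero) auto
      ultimately show "\<exists>y. ((\<lambda>x. x * cos x - sin x) has_real_derivative y) (at u) \<and> y \<le> 0"
        by (intro exI[of _ "- (u * sin u)"]) (auto intro!: derivative_eq_intros)
    qed
    then have "(x * cos x - sin x) * exp (x\<^sup>2 / 2) \<le> 0"
      by (intro mult_nonpos_nonneg) auto
    moreover have "((\<lambda>x. cos x * exp (x\<^sup>2 / 2)) has_real_derivative
        (x * cos x - sin x) * exp (x\<^sup>2 / 2)) (at x)"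
      by (auto intro!: derivative_eq_intros simp: algebra_simps)
    ultimately show "\<exists>y. ((\<lambda>x. cos x * exp (x\<^sup>2 / 2)) has_real_derivative y) (at x) \<and> y \<le> 0"
      by blast
  qed
  then show ?thesis by (simp add: a_def exp_minus field_simps)
qed

text \<open>Passing from \<open>Re u\<close> to \<open>cmod u\<close> enlarges \<open>cosh\<close>
  at most by the factor \<open>exp ((Im u)\<^sup>2 / 2)\<close>, and \<open>cos (Im u)\<close> is at
  most the inverse of this factor.\<close>

lemma cosh_norm_mult_cos_Im_le:
  assumes "\<bar>Im u\<bar> < pi / 2"
  shows "cosh (cmod u) * cos (Im u) \<le> cosh (Re u)"
proof -
  have 1: "cosh (cmod u) * exp (- (cmod u)\<^sup>2 / 2) \<le> cosh \<bar>Re u\<bar> * exp (- \<bar>Re u\<bar>\<^sup>2 / 2)"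
    by (intro cosh_exp_antimono) (auto simp: abs_Re_le_cmod)
  have "- \<bar>Re u\<bar>\<^sup>2 / 2 = - (cmod u)\<^sup>2 / 2 + (Im u)\<^sup>2 / 2"
    by (simp add: cmod_power2 field_simps)
  then have "cosh (cmod u) * exp (- (cmod u)\<^sup>2 / 2)
      \<le> cosh (Re u) * exp ((Im u)\<^sup>2 / 2) * exp (- (cmod u)\<^sup>2 / 2)"
    using 1 by (simp only: exp_add cosh_real_abs) (simp add: mult_ac)
  then have 2: "cosh (cmod u) \<le> cosh (Re u) * exp ((Im u)\<^sup>2 / 2)"
    by simp
  have "cosh (cmod u) * cos (Im u) \<le> cosh (Re u) * exp ((Im u)\<^sup>2 / 2) * exp (- (Im u)\<^sup>2 / 2)"
    using assms by (intro mult_mono 2 cos_le_exp cos_ge_zero) auto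
  also have "\<dots> = cosh (Re u)"
    by (simp add: mult.assoc flip: exp_add)
  finally show ?thesis .
qed

text \<open>Written in terms of \<open>u\<close>, the condition \<open>cmod \<zeta> < b\<close>
  becomes \<open>cosh (Re v) < exp (- x0) * cos (Im v)\<close>. The preceding inequality then allows
  the cosine to be cancelled, leaving \<open>cosh (cmod v) < cosh \<rho>\<close>.\<close>

lemma Ln_in_disc:
  fixes b :: real
  assumes "cmod \<zeta> < b" "b < 1"
  shows "cmod (Ln (1 + \<zeta>) - of_real ((ln (1 + b) + ln (1 - b)) / 2)) < (ln (1 + b) - ln (1 - b)) / 2"
proof -
  define x0 \<rho> where "x0 = (ln (1 + b) + ln (1 - b)) / 2" and "\<rho> = (ln (1 + b) - ln (1 - b)) / 2"
  define u where "u = Ln (1 + \<zeta>)"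
  define v where "v = u - of_real x0"
  have b: "0 < b" using assms norm_ge_zero[of \<zeta>] by linarith
  have "0 < Re (1 + \<zeta>)" using assms abs_Re_le_cmod[of \<zeta>] by simp
  then have nz: "1 + \<zeta> \<noteq> 0" and Im: "\<bar>Im u\<bar> < pi / 2"
    unfolding u_def by (metis less_irrefl zero_complex.sel(1), rule Re_Ln_pos_lt_imp)
  have eu: "exp u = 1 + \<zeta>" using nz by (simp add: u_def)
  have "2 * x0 = ln (1 + b) + ln (1 - b)"
    by (simp add: x0_def)
  then have e0: "exp (2 * x0) = 1 - b\<^sup>2"
    using b assms by (simp only: exp_add) (simp add: power2_eq_square algebra_simps)
  have "(cmod \<zeta>)\<^sup>2 < b\<^sup>2" using assms by (intro power_strict_mono) auto
  moreover have "(cmod \<zeta>)\<^sup>2 = (cmod (exp u - 1))\<^sup>2" by (simp add: eu)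
  also have "\<dots> = (exp (Re u))\<^sup>2 * (cos (Im u))\<^sup>2 + (exp (Re u))\<^sup>2 * (sin (Im u))\<^sup>2
      - 2 * exp (Re u) * cos (Im u) + 1"
    unfolding cmod_power2 by (simp add: Re_exp Im_exp power2_eq_square algebra_simps)
  also have "\<dots> = exp (2 * Re u) - 2 * exp (Re u) * cos (Im u) + 1"
    by (simp add: exp_double flip: distrib_left)
  finally have "exp (2 * Re u) + exp (2 * x0) < 2 * exp (Re u) * cos (Im u)"
    using e0 by simp
  \<comment> \<open>This factor balances the two exponentials into a hyperbolic cosine centred at
    \<open>x0\<close>.\<close>
  then have "exp (- Re u - x0) * (exp (2 * Re u) + exp (2 * x0)) < exp (- Re u - x0) * (2 * exp (Re u) * cos (Im u))"
    by simp
  moreover have "exp (- Re u - x0) * (exp (2 * Re u) + exp (2 * x0)) = 2 * cosh (Re v)"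
    by (simp add: v_def cosh_field_def distrib_left flip: exp_add)
  moreover have "exp (- Re u - x0) * (2 * exp (Re u) * cos (Im u)) = 2 * (exp (- x0) * cos (Im u))"
    by (simp add: exp_diff exp_minus field_simps)
  ultimately have "cosh (Re v) < exp (- x0) * cos (Im u)"
    by simp
  moreover have "cosh (cmod v) * cos (Im v) \<le> cosh (Re v)"
    using Im by (intro cosh_norm_mult_cos_Im_le) (simp add: v_def)
  ultimately have "cosh (cmod v) * cos (Im u) < exp (- x0) * cos (Im u)"
    by (simp add: v_def)
  then have "cosh (cmod v) < exp (- x0)"
    using Im by (simp add: cos_gt_zero_pi)
  also have "exp (- x0) = exp (- x0) * ((1 + b) + (1 - b)) / 2" by simp
  also have "\<dots> = exp (- x0) * (exp (ln (1 + b)) + exp (ln (1 - b))) / 2"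
    using b assms by simp
  also have "\<dots> = cosh \<rho>"
    unfolding distrib_left exp_add[symmetric] by (simp add: x0_def \<rho>_def cosh_field_def field_simps)
  finally have "cosh (cmod v) < cosh \<rho>" .
  moreover have "0 \<le> \<rho>" using b assms by (simp add: \<rho>_def)
  ultimately have "cmod v < \<rho>" by (simp add: cosh_real_nonneg_less_iff)
  then show ?thesis by (simp add: v_def u_def x0_def \<rho>_def)
qed

text \<open>The primitive of \<open>1 / (1 + B * t)\<close> vanishing at 0; the case
  \<open>B = 0\<close> is the limit of the other one.\<close>

definition scaled_ln :: "real \<Rightarrow> real \<Rightarrow> real" where
  "scaled_ln B t = (if B = 0 then t else ln (1 + B * t) / B)"

definition scaled_Ln :: "real \<Rightarrow> complex \<Rightarrow> complex" where
  "scaled_Ln B z = (if B = 0 then z else Ln (1 + of_real B * z) / of_real B)"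

lemma scaled_Ln_0 [simp]: "scaled_Ln B 0 = 0"
  and scaled_ln_0 [simp]: "scaled_ln B 0 = 0"
  by (simp_all add: scaled_Ln_def scaled_ln_def)

lemma one_plus_mult_Re_pos:
  assumes "\<bar>B\<bar> < 1" "cmod z < 1"
  shows "0 < Re (1 + of_real B * z)"
proof -
  have "\<bar>B * Re z\<bar> \<le> 1 * cmod z"
    unfolding abs_mult using assms abs_Re_le_cmod by (intro mult_mono) auto
  then show ?thesis using assms by simp
qed

lemma one_plus_mult_nonzero:
  assumes "\<bar>B\<bar> < 1" "cmod z < 1"
  shows "1 + of_real B * z \<noteq> 0"
  using one_plus_mult_Re_pos[OF assms] by (metis less_irrefl zero_complex.sel(1))

lemma scaled_Ln_deriv:
  assumes "\<bar>B\<bar> < 1" "cmod z < 1"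
  shows "(scaled_Ln B has_field_derivative 1 / (1 + of_real B * z)) (at z)"
proof (cases "B = 0")
  case True
  then have "scaled_Ln B = (\<lambda>z. z)" by (simp add: scaled_Ln_def fun_eq_iff)
  then show ?thesis using True by simp
next
  case False
  have "1 + of_real B * z \<notin> \<real>\<^sub>\<le>\<^sub>0"
    using one_plus_mult_Re_pos[OF assms] by (auto simp: complex_nonpos_Reals_iff)
  then show ?thesis
    unfolding scaled_Ln_def[abs_def] using False
    by (auto intro!: derivative_eq_intros simp: divide_simps)
qed

lemma scaled_Ln_of_real:
  assumes "\<bar>B\<bar> < 1" "\<bar>t\<bar> < 1"
  shows "scaled_Ln B (of_real t) = of_real (scaled_ln B t)"
proof -
  have "0 < 1 + B * t"
    using one_plus_mult_Re_pos[of B "of_real t"] assms by simp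
  then have "Ln (of_real (1 + B * t)) = of_real (ln (1 + B * t))"
    by (rule Ln_of_real)
  then show ?thesis by (simp add: scaled_Ln_def scaled_ln_def)
qed

lemma scaled_ln_sign:
  assumes "\<bar>B\<bar> < 1"
  shows "0 < scaled_ln B 1" "scaled_ln B (-1) < 0"
proof -
  consider "B = 0" | "0 < B" "0 < ln (1 + B)" "ln (1 - B) < 0" | "B < 0" "ln (1 + B) < 0" "0 < ln (1 - B)"
    using assms by (cases B "0 :: real" rule: linorder_cases) auto
  then have "0 < scaled_ln B 1 \<and> scaled_ln B (-1) < 0"
    by cases (simp_all add: scaled_ln_def zero_less_divide_iff divide_less_0_iff)
  then show "0 < scaled_ln B 1" "scaled_ln B (-1) < 0" by auto
qed

lemma continuous_on_scaled_ln:
  assumes "\<bar>B\<bar> < 1"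
  shows "continuous_on {-1..1} (scaled_ln B)"
proof -
  have "1 + B * t \<noteq> 0" if "t \<in> {-1..1}" for t
  proof -
    have "\<bar>B * t\<bar> \<le> \<bar>B\<bar> * 1"
      unfolding abs_mult using that by (intro mult_left_mono) auto
    then show ?thesis using assms by linarith
  qed
  then show ?thesis
    unfolding scaled_ln_def[abs_def] by (cases "B = 0") (auto intro!: continuous_intros)
qed

text \<open>This is \<open>Ln_in_disc\<close> with \<open>b = |B|\<close>, divided by
  \<open>|B|\<close>. For negative \<open>B\<close> the two logarithms swap, which leaves their sum
  alone and flips their difference together with the sign of \<open>B\<close>.\<close>

lemma scaled_Ln_in_disc:
  assumes B: "\<bar>B\<bar> < 1" and v: "cmod v < 1"
  shows "cmod (scaled_Ln B v - of_real ((scaled_ln B 1 + scaled_ln B (-1)) / 2))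
    < (scaled_ln B 1 - scaled_ln B (-1)) / 2"
proof (cases "B = 0")
  case False
  have "cmod (of_real B * v) < \<bar>B\<bar>"
    using False v by (simp add: norm_mult)
  from Ln_in_disc[OF this B]
  have "cmod (Ln (1 + of_real B * v) - of_real ((ln (1 + B) + ln (1 - B)) / 2)) / \<bar>B\<bar>
      < ((ln (1 + \<bar>B\<bar>) - ln (1 - \<bar>B\<bar>)) / 2) / \<bar>B\<bar>"
    using False by (intro divide_strict_right_mono) (auto simp: abs_if add.commute split: if_splits)
  also have "\<dots> = (scaled_ln B 1 - scaled_ln B (-1)) / 2"
    using False by (auto simp: scaled_ln_def abs_if field_simps)
  also have "cmod (Ln (1 + of_real B * v) - of_real ((ln (1 + B) + ln (1 - B)) / 2)) / \<bar>B\<bar>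
      = cmod ((Ln (1 + of_real B * v) - of_real ((ln (1 + B) + ln (1 - B)) / 2)) / of_real B)"
    by (simp add: norm_divide)
  also have "(Ln (1 + of_real B * v) - of_real ((ln (1 + B) + ln (1 - B)) / 2)) / of_real B
      = scaled_Ln B v - of_real ((scaled_ln B 1 + scaled_ln B (-1)) / 2)"
    using False by (simp add: scaled_Ln_def scaled_ln_def field_simps)
  finally show ?thesis .
qed (use v in \<open>simp add: scaled_Ln_def scaled_ln_def\<close>)

lemma ball_diameter_mono:
  fixes a b c d :: real
  assumes "a \<le> c" "d \<le> b" "cmod (z - of_real ((c + d) / 2)) < (d - c) / 2"
  shows "cmod (z - of_real ((a + b) / 2)) < (b - a) / 2"
proof -
  have "cmod (z - of_real ((a + b) / 2)) \<le> cmod (z - of_real ((c + d) / 2)) + \<bar>(c + d) / 2 - (a + b) / 2\<bar>"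
    using norm_triangle_ineq[of "z - of_real ((c + d) / 2)" "of_real ((c + d) / 2 - (a + b) / 2)"]
    by (simp only: norm_of_real) (simp add: algebra_simps)
  then show ?thesis using assms by argo
qed

section \<open>Subordination\<close>

text \<open>As \<open>v z0\<close> is unimodular, \<open>d\<close> equals
  \<open>z0 * deriv v z0 / v z0\<close>. Its imaginary and real parts are read off from the
  derivatives of the squared modulus of \<open>v\<close> along the circle and along the radius
  through \<open>z0\<close>.\<close>

lemma Jack_lemma:
  assumes holo: "v holomorphic_on ball 0 1" and v0: "v 0 = 0"
    and z0: "cmod z0 < 1" "cmod (v z0) = 1" and lt: "\<And>z. cmod z < cmod z0 \<Longrightarrow> cmod (v z) < 1"
  shows "\<exists>m\<ge>1. z0 * deriv v z0 = of_real m * v z0"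
proof -
  define r where "r = cmod z0"
  define d where "d = z0 * deriv v z0 * cnj (v z0)"
  have r: "0 < r" "r < 1" using v0 z0 by (auto simp: r_def)
  have dv: "(v has_field_derivative deriv v z) (at z)" if "cmod z < 1" for z
    using holo that by (intro holomorphic_derivI[of v "ball 0 1"]) auto
  have sq: "((\<lambda>t. (cmod (f t))\<^sup>2) has_real_derivative 2 * Re (f' * cnj (f x))) (at x)"
    if "(f has_vector_derivative f') (at x)" for f f' x
  proof -
    have "((\<lambda>t. f t \<bullet> f t) has_vector_derivative (f x \<bullet> f' + f' \<bullet> f x)) (at x)"
      by (intro bounded_bilinear.has_vector_derivative[OF bounded_bilinear_inner] that)
    then show ?thesis
      by (simp add: has_real_derivative_iff_has_vector_derivative power2_norm_eq_inner
          inner_complex_def algebra_simps)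
  qed
  have schwarz: "cmod (v (of_real r * \<zeta>)) \<le> cmod \<zeta>" if "cmod \<zeta> < 1" for \<zeta>
  proof (rule Schwarz_Lemma(1)[OF _ _ _ that])
    have "r * cmod \<zeta> < 1" if "cmod \<zeta> < 1" for \<zeta>
      using that r mult_left_le_one_le[of "cmod \<zeta>" r] by simp
    then show "(\<lambda>\<zeta>. v (of_real r * \<zeta>)) holomorphic_on ball 0 1"
      using r by (intro holomorphic_on_compose_gen[OF _ holo, unfolded o_def] holomorphic_intros)
        (auto simp: norm_mult)
    show "cmod (v (of_real r * z)) < 1" if "cmod z < 1" for z
      using that r by (intro lt) (simp add: norm_mult r_def)
  qed (simp add: v0)

  \<comment> \<open>Tangentially, \<open>\<bar>v\<bar>\<close> has a local maximum at \<open>z0\<close>.\<close>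
  have "((\<lambda>t. v (z0 * exp (\<i> * of_real t))) has_vector_derivative \<i> * z0 * deriv v z0) (at (0::real))"
  proof -
    have "((\<lambda>t. v (z0 * exp (\<i> * t))) has_field_derivative \<i> * z0 * deriv v z0) (at (of_real 0))"
      by (rule DERIV_chain2[of v, THEN DERIV_cong, OF dv])
         (auto intro!: derivative_eq_intros simp: z0)
    then show ?thesis
      using has_vector_derivative_real_field by fastforce
  qed
  from sq[OF this] have "((\<lambda>t. (cmod (v (z0 * exp (\<i> * of_real t))))\<^sup>2) has_real_derivative - 2 * Im d) (at 0)"
    by (simp add: d_def algebra_simps)
  then have "- 2 * Im d = 0"
  proof (rule DERIV_local_max[OF _ zero_less_one], intro allI impI)
    fix t :: real
    have "cmod (v (z0 * exp (\<i> * of_real t))) \<le> 1"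
    proof (rule ccontr)
      let ?w = "z0 * exp (\<i> * of_real t)"
      assume *: "\<not> cmod (v ?w) \<le> 1"
      have "continuous_on (cball 0 r) v"
        using holo r by (intro holomorphic_on_imp_continuous_on holomorphic_on_subset[OF holo]) auto
      moreover have "cmod (v z) \<le> 1" if "z \<in> ball 0 r" for z
        using lt[of z] that by (simp add: r_def)
      ultimately have "cmod (v ?w) \<le> 1"
        using continuous_on_closure_norm_le[of "ball 0 r" v 1 ?w] r by (simp add: norm_mult r_def)
      with * show False by simp
    qed
    then show "(cmod (v (z0 * exp (\<i> * of_real t))))\<^sup>2 \<le> (cmod (v (z0 * exp (\<i> * of_real 0))))\<^sup>2"
      using z0 by (simp add: power_le_one)
  qed
  then have Im: "Im d = 0" by simp

  \<comment> \<open>Radially, \<open>\<bar>v (t z0)\<bar> \<le> t\<close> with equality at \<open>t = 1\<close>.\<close>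
  have "((\<lambda>t. v (of_real t * z0)) has_vector_derivative z0 * deriv v z0) (at (1::real))"
  proof -
    have "((\<lambda>t. v (t * z0)) has_field_derivative z0 * deriv v z0) (at (of_real 1))"
      by (rule DERIV_chain2[of v, THEN DERIV_cong, OF dv])
         (auto intro!: derivative_eq_intros simp: z0)
    then show ?thesis
      using has_vector_derivative_real_field by fastforce
  qed
  from sq[OF this] have "((\<lambda>t. (cmod (v (of_real t * z0)))\<^sup>2) has_real_derivative 2 * Re d) (at 1)"
    by (simp add: d_def)
  then have der: "((\<lambda>t. (cmod (v (of_real t * z0)))\<^sup>2 - t\<^sup>2) has_real_derivative 2 * Re d - 2) (at 1)"
    by (rule DERIV_diff[THEN DERIV_cong]) (auto intro!: derivative_eq_intros)
  have Re: "1 \<le> Re d"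
  proof (rule ccontr)
    assume "\<not> 1 \<le> Re d"
    then obtain e where e: "e > 0" and *: "\<And>h. 0 < h \<Longrightarrow> h < e \<Longrightarrow>
        (cmod (v (of_real 1 * z0)))\<^sup>2 - 1\<^sup>2 < (cmod (v (of_real (1 - h) * z0)))\<^sup>2 - (1 - h)\<^sup>2"
      using DERIV_neg_dec_left[OF der] by auto
    \<comment> \<open>The cap \<open>1 / 2\<close> keeps \<open>1 - h\<close> positive, so that it
      is the modulus of a point to which \<open>schwarz\<close> applies.\<close>
    define h where "h = min (e / 2) (1 / 2)"
    have h: "0 < h" "h < e" "h < 1" using e by (auto simp: h_def)
    have "of_real (1 - h) * z0 = of_real r * (of_real (1 - h) * sgn z0)"
      by (simp add: sgn_eq r_def)
    moreover have "cmod (of_real (1 - h) * sgn z0) = 1 - h"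
      using h r by (simp add: norm_mult norm_sgn r_def del: of_real_diff)
    ultimately have "cmod (v (of_real (1 - h) * z0)) \<le> 1 - h"
      using schwarz[of "of_real (1 - h) * sgn z0"] h by (metis diff_less_eq less_add_same_cancel1)
    then have "(cmod (v (of_real (1 - h) * z0)))\<^sup>2 \<le> (1 - h)\<^sup>2"
      by (rule power_mono) simp
    then show False using *[OF h(1,2)] z0 by simp
  qed
  have "d = of_real (Re d)" using Im by (simp add: complex_eq_iff)
  moreover have "cnj (v z0) * v z0 = 1"
    using complex_norm_square[of "v z0"] z0 by (simp add: mult.commute)
  then have "z0 * deriv v z0 = d * v z0"
    by (simp add: d_def mult.assoc)
  ultimately show ?thesis using Re by metis
qed

text \<open>At a point of least modulus with \<open>cmod (v z0) = 1\<close>, Jack's lemma turns the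
  equation into \<open>m * v z0 = w z0 * (1 - (m - 1) * B * v z0)\<close>. Taking moduli gives
  \<open>m < 1 + (m - 1) * |B|\<close>, which contradicts \<open>1 \<le> m\<close>.\<close>

lemma logarithmic_schwarz:
  assumes holo: "v holomorphic_on ball 0 1" and v0: "v 0 = 0" and B: "\<bar>B\<bar> < 1"
    and w: "\<And>z. cmod z < 1 \<Longrightarrow> cmod (w z) < 1"
    and eq: "\<And>z. cmod z < 1 \<Longrightarrow>
      z * deriv v z * (1 + of_real B * w z) = (1 + of_real B * v z) * w z"
    and z: "cmod z < 1"
  shows "cmod (v z) < 1"
proof (rule ccontr)
  assume "\<not> cmod (v z) < 1"
  define K where "K = cball 0 (cmod z) \<inter> {z. 1 \<le> cmod (v z)}"
  have sub: "cball 0 (cmod z) \<subseteq> ball (0::complex) 1" using z by auto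
  have cont: "continuous_on (ball 0 1) v"
    using holo by (rule holomorphic_on_imp_continuous_on)
  have "closed (cball 0 (cmod z) \<inter> (\<lambda>z. cmod (v z)) -` {1..})"
    using continuous_on_subset[OF cont sub]
    by (intro continuous_closed_preimage continuous_on_norm) auto
  then have "compact K"
    by (simp add: K_def compact_eq_bounded_closed vimage_def bounded_Int)
  moreover have "z \<in> K"
    using \<open>\<not> cmod (v z) < 1\<close> by (simp add: K_def)
  ultimately obtain z0 where z0: "z0 \<in> K" "\<And>y. y \<in> K \<Longrightarrow> cmod z0 \<le> cmod y"
    using continuous_attains_inf[of K norm] by (auto intro: continuous_intros)
  have z01: "cmod z0 < 1" using z0(1) z by (simp add: K_def)
  have lt: "cmod (v y) < 1" if "cmod y < cmod z0" for y
    using z0(2)[of y] z0(1) that by (fastforce simp: K_def)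
  have "z0 \<noteq> 0" using z0(1) v0 by (auto simp: K_def)
  have "cmod (v z0) \<le> 1"
  proof (rule continuous_on_closure_norm_le[of "ball 0 (cmod z0)" v])
    show "continuous_on (closure (ball 0 (cmod z0))) v"
      using \<open>z0 \<noteq> 0\<close> z01 by (intro continuous_on_subset[OF cont]) auto
    show "\<forall>y\<in>ball 0 (cmod z0). cmod (v y) \<le> 1"
      using lt by (simp add: less_imp_le)
  qed (use \<open>z0 \<noteq> 0\<close> in auto)
  then have v1: "cmod (v z0) = 1" using z0(1) by (simp add: K_def)
  obtain m where m: "1 \<le> m" "z0 * deriv v z0 = of_real m * v z0"
    using Jack_lemma[OF holo v0 z01 v1 lt] by blast
  define t where "t = (m - 1) * \<bar>B\<bar>"
  have t: "0 \<le> t" "t \<le> (m - 1) * 1"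
    unfolding t_def using m(1) B by (auto intro: mult_left_mono simp del: mult_1_right)
  have "of_real m * v z0 = w z0 * (1 - of_real ((m - 1) * B) * v z0)"
    using eq[OF z01] m(2) by (simp add: algebra_simps)
  then have "cmod (of_real m * v z0) = cmod (w z0) * cmod (1 - of_real ((m - 1) * B) * v z0)"
    by (simp only: norm_mult)
  then have "m = cmod (w z0) * cmod (1 - of_real ((m - 1) * B) * v z0)"
    using m(1) v1 by (simp add: norm_mult)
  also have "\<dots> \<le> cmod (w z0) * (1 + t)"
    using norm_triangle_ineq4[of 1 "of_real ((m - 1) * B) * v z0"] m(1) v1
    by (intro mult_left_mono) (simp_all add: t_def norm_mult abs_mult del: of_real_mult)
  also have "\<dots> < 1 * (1 + t)"
    using w[OF z01] t(1) by (intro mult_strict_right_mono) auto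
  finally show False using t(2) by simp
qed

text \<open>The assumptions \<open>right\<close> and \<open>left\<close> place the diameter from
  \<open>q(-1)\<close> to \<open>q(1)\<close>, shifted by 1, inside the one belonging to
  \<open>coshsqrt\<close>.\<close>

lemma subordination_implicationI:
  fixes A B \<eta> :: real
  defines "c \<equiv> (A - B) / \<eta>"
  assumes B: "\<bar>B\<bar> < 1" and "B < A" "0 < \<eta>"
    and right: "c * scaled_ln B 1 \<le> cosh 1 - 1" and left: "cos 1 - 1 \<le> c * scaled_ln B (-1)"
  shows "subordination_implication A B \<eta>"
  unfolding subordination_implication_def
proof (intro allI impI)
  fix p
  assume holo: "p holomorphic_on ball 0 1" and p0: "p 0 = 1"
    and sub: "(\<lambda>z. 1 + of_real \<eta> * z * deriv p z) \<prec>\<^sub>D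
          (\<lambda>z. (1 + of_real A * z) / (1 + of_real B * z))"
  from sub obtain w where w: "\<And>z. cmod z < 1 \<Longrightarrow> cmod (w z) < 1"
    and eq: "\<And>z. cmod z < 1 \<Longrightarrow>
      1 + of_real \<eta> * z * deriv p z = (1 + of_real A * w z) / (1 + of_real B * w z)"
    by (rule subordinateE) blast
  have c: "0 < c" using assms by (simp add: c_def)
  have dp: "(p has_field_derivative deriv p z) (at z)" if "cmod z < 1" for z
    using holo that by (intro holomorphic_derivI[of p "ball 0 1"]) auto
  have p_eq: "z * deriv p z * (1 + of_real B * w z) = of_real c * w z" if "cmod z < 1" for z
  proof -
    have "(1 + of_real \<eta> * z * deriv p z) * (1 + of_real B * w z) = 1 + of_real A * w z"
      using eq[OF that] one_plus_mult_nonzero[OF B w[OF that]] by simp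
    then have "of_real \<eta> * (z * deriv p z * (1 + of_real B * w z)) = of_real (A - B) * w z"
      by (simp add: algebra_simps)
    then show ?thesis
      using \<open>0 < \<eta>\<close> by (simp add: c_def field_simps)
  qed
  \<comment> \<open>This solves \<open>p = 1 + c * scaled_Ln B v\<close> for \<open>v\<close>; going
    through \<open>exp\<close> gives a function on the whole disc before any branch of the logarithm
    is available.\<close>
  define v where "v z = (if B = 0 then (p z - 1) / of_real c
    else (exp (of_real (B / c) * (p z - 1)) - 1) / of_real B)" for z
  have exp_v: "exp (of_real (B / c) * (p z - 1)) = 1 + of_real B * v z" for z
    by (simp add: v_def)
  have dv: "(v has_field_derivative (1 + of_real B * v z) * deriv p z / of_real c) (at z)"
    if "cmod z < 1" for z
    unfolding exp_v[symmetric] v_def[abs_def] using c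
    by (cases "B = 0") (auto intro!: derivative_eq_intros dp[OF that])
  have v_lt: "cmod (v z) < 1" if "cmod z < 1" for z
  proof (rule logarithmic_schwarz[OF _ _ B w _ that])
    show "v holomorphic_on ball 0 1"
      unfolding holomorphic_on_open[OF open_ball] using dv by (meson mem_ball_0)
    show "v 0 = 0" by (simp add: v_def p0)
    show "z * deriv v z * (1 + of_real B * w z) = (1 + of_real B * v z) * w z" if "cmod z < 1" for z
    proof -
      have "z * deriv v z * (1 + of_real B * w z)
          = (1 + of_real B * v z) / of_real c * (z * deriv p z * (1 + of_real B * w z))"
        using DERIV_imp_deriv[OF dv[OF that]] by simp
      then show ?thesis using c by (simp add: p_eq[OF that])
    qed
  qed
  \<comment> \<open>Comparing derivatives singles out the principal branch of the logarithm.\<close>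
  have p_v: "p z = 1 + of_real c * scaled_Ln B (v z)" if "cmod z < 1" for z
  proof -
    have "((\<lambda>z. p z - of_real c * scaled_Ln B (v z)) has_field_derivative 0) (at x within ball 0 1)"
      if "x \<in> ball 0 1" for x
    proof -
      have x: "cmod x < 1" using that by simp
      have "((\<lambda>z. scaled_Ln B (v z)) has_field_derivative
          1 / (1 + of_real B * v x) * ((1 + of_real B * v x) * deriv p x / of_real c)) (at x)"
        by (rule DERIV_chain2[OF scaled_Ln_deriv[OF B v_lt[OF x]] dv[OF x]])
      from DERIV_diff[OF dp[OF x] DERIV_cmult[OF this, of "of_real c"]]
      have "((\<lambda>z. p z - of_real c * scaled_Ln B (v z)) has_field_derivative 0) (at x)"
        using c one_plus_mult_nonzero[OF B v_lt[OF x]] by simp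
      then show ?thesis by (rule has_field_derivative_at_within)
    qed
    then have "\<exists>k. \<forall>x\<in>ball 0 1. p x - of_real c * scaled_Ln B (v x) = k"
      by (rule has_field_derivative_zero_constant[OF convex_ball])
    then obtain k where k: "\<And>x. x \<in> ball 0 1 \<Longrightarrow> p x - of_real c * scaled_Ln B (v x) = k"
      by blast
    have "v 0 = 0" by (simp add: v_def p0)
    then show ?thesis using k[of 0] k[of z] that p0 by (simp add: algebra_simps)
  qed
  show "p \<prec>\<^sub>D coshsqrt"
  proof (rule subordinate_coshsqrtI[OF holo p0], rule image_subsetI)
    fix z :: complex assume "z \<in> ball 0 1"
    then have z: "cmod z < 1" by simp
    have "p z - 1 - of_real ((c * scaled_ln B (-1) + c * scaled_ln B 1) / 2)
        = of_real c * (scaled_Ln B (v z) - of_real ((scaled_ln B 1 + scaled_ln B (-1)) / 2))"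
      unfolding p_v[OF z] by (simp add: right_diff_distrib distrib_left add_divide_distrib)
    then have "cmod (p z - 1 - of_real ((c * scaled_ln B (-1) + c * scaled_ln B 1) / 2))
        = c * cmod (scaled_Ln B (v z) - of_real ((scaled_ln B 1 + scaled_ln B (-1)) / 2))"
      using c by (simp only: norm_mult norm_of_real abs_of_pos)
    also have "\<dots> < c * ((scaled_ln B 1 - scaled_ln B (-1)) / 2)"
      using c by (intro mult_strict_left_mono scaled_Ln_in_disc B v_lt z)
    also have "\<dots> = (c * scaled_ln B 1 - c * scaled_ln B (-1)) / 2"
      by (simp add: right_diff_distrib)
    finally have "cmod (p z - 1 - of_real ((cos 1 - 1 + (cosh 1 - 1)) / 2))
        < (cosh 1 - 1 - (cos 1 - 1)) / 2"
      by (rule ball_diameter_mono[OF left right])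
    moreover have "p z - 1 - of_real ((cos 1 - 1 + (cosh 1 - 1)) / 2)
        = p z - of_real ((cosh 1 + cos 1) / 2)"
      by (simp add: add_divide_distrib diff_divide_distrib)
    ultimately have "p z \<in> ball (of_real ((cosh 1 + cos 1) / 2)) ((cosh 1 - cos 1) / 2)"
      by (simp only: mem_ball dist_commute[of _ "p z"]) (simp add: dist_norm)
    then show "p z \<in> coshsqrt ` ball 0 1"
      using disc_subset_coshsqrt_image by blast
  qed
qed

text \<open>The function \<open>q\<close> satisfies the differential hypothesis with the identity as
  self-map. It is real on the real diameter, where \<open>big\<close> and the intermediate value
  theorem make it take a value that \<open>avoid\<close> excludes.\<close>

lemma not_subordination_implicationI:
  fixes A B \<eta> :: real
  defines "c \<equiv> (A - B) / \<eta>"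
  assumes B: "\<bar>B\<bar> < 1" and "0 < \<eta>"
    and big: "cosh 1 - 1 < c * scaled_ln B 1 \<or> c * scaled_ln B (-1) < cos 1 - 1"
  shows "\<not> subordination_implication A B \<eta>"
proof
  assume impl: "subordination_implication A B \<eta>"
  define q where "q z = 1 + of_real c * scaled_Ln B z" for z
  have dq: "(q has_field_derivative of_real c / (1 + of_real B * z)) (at z)" if "cmod z < 1" for z
    unfolding q_def[abs_def]
    by (auto intro!: derivative_eq_intros scaled_Ln_deriv B that)
  have "q holomorphic_on ball 0 1"
    unfolding holomorphic_on_open[OF open_ball] using dq by (meson mem_ball_0)
  moreover have "q 0 = 1" by (simp add: q_def)
  moreover have "(\<lambda>z. 1 + of_real \<eta> * z * deriv q z) \<prec>\<^sub>D
      (\<lambda>z. (1 + of_real A * z) / (1 + of_real B * z))"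
    unfolding subordinate_def
  proof (intro exI[of _ "\<lambda>z. z"] conjI ballI)
    fix z :: complex assume "z \<in> ball 0 1"
    then have z: "cmod z < 1" by simp
    show "1 + of_real \<eta> * z * deriv q z = (1 + of_real A * z) / (1 + of_real B * z)"
    proof -
      have "of_real \<eta> * of_real c = complex_of_real (A - B)"
        using \<open>0 < \<eta>\<close> by (simp add: c_def)
      then have "1 + of_real \<eta> * z * deriv q z = 1 + of_real (A - B) * z / (1 + of_real B * z)"
        by (simp add: DERIV_imp_deriv[OF dq[OF z]] mult.commute mult.left_commute)
      then show ?thesis
        using one_plus_mult_nonzero[OF B z] by (simp add: field_simps)
    qed
  qed auto
  ultimately have "q \<prec>\<^sub>D coshsqrt"
    using impl unfolding subordination_implication_def by blast
  then obtain w where w: "\<And>z. cmod z < 1 \<Longrightarrow> cmod (w z) < 1"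
    and qw: "\<And>z. cmod z < 1 \<Longrightarrow> q z = coshsqrt (w z)"
    by (rule subordinateE) blast
  have avoid: "q (of_real t) \<noteq> coshsqrt s" if "\<bar>t\<bar> < 1" "cmod s = 1" for t s
  proof
    assume "q (of_real t) = coshsqrt s"
    with qw[of "of_real t"] that have "coshsqrt (w (of_real t)) = coshsqrt s" by simp
    moreover have "w (of_real t) \<in> cball 0 1" "s \<in> cball 0 1"
      using w[of "of_real t"] that by (simp_all add: less_imp_le)
    ultimately have "w (of_real t) = s"
      by (rule inj_onD[OF coshsqrt_inj])
    then show False using w[of "of_real t"] that by auto
  qed
  have q_real: "q (of_real t) = of_real (1 + c * scaled_ln B t)" if "\<bar>t\<bar> < 1" for t
    using that by (simp add: q_def scaled_Ln_of_real B)
  have cont: "continuous_on {-1..1} (\<lambda>t. c * scaled_ln B t)"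
    by (rule continuous_on_mult_left[OF continuous_on_scaled_ln[OF B]])
  from big show False
  proof
    assume gt: "cosh 1 - 1 < c * scaled_ln B 1"
    have "\<exists>t\<ge>0. t \<le> 1 \<and> c * scaled_ln B t = cosh 1 - 1"
      using gt cosh_cos_1_bounds continuous_on_subset[OF cont, of "{0..1}"]
        IVT'[of "\<lambda>t. c * scaled_ln B t" 0 "cosh 1 - 1" 1] by auto
    then obtain t where "0 \<le> t" "t \<le> 1" and t: "c * scaled_ln B t = cosh 1 - 1" by blast
    moreover have "t \<noteq> 1" using t gt by auto
    ultimately have "\<bar>t\<bar> < 1" by simp
    then show False
      using avoid[of t 1] q_real[of t] t by (simp add: coshsqrt_1)
  next
    assume lt: "c * scaled_ln B (-1) < cos 1 - 1"
    have "\<exists>t\<ge>-1. t \<le> 0 \<and> c * scaled_ln B t = cos 1 - 1"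
      using lt cosh_cos_1_bounds continuous_on_subset[OF cont, of "{-1..0}"]
        IVT'[of "\<lambda>t. c * scaled_ln B t" "-1" "cos 1 - 1" 0] by auto
    then obtain t where "-1 \<le> t" "t \<le> 0" and t: "c * scaled_ln B t = cos 1 - 1" by blast
    moreover have "t \<noteq> -1" using t lt by auto
    ultimately have "\<bar>t\<bar> < 1" by simp
    then show False
      using avoid[of t "-1"] q_real[of t] t by (simp add: coshsqrt_minus_1)
  qed
qed

section \<open>The critical parameter\<close>

text \<open>A concave function with zeros \<open>B\<^sub>0\<close> and 0 is nonnegative between them
  and nonpositive outside. Each case writes one of the three points as a convex combination of the
  other two.\<close>

lemma root_condition:
  fixes B B\<^sub>0 \<mu> :: real
  assumes "\<bar>B\<bar> < 1" "-1 < B\<^sub>0" "B\<^sub>0 < 0" "(1 + B\<^sub>0) * (1 - B\<^sub>0) powr \<mu> = 1" "0 < \<mu>"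
  shows "B \<le> B\<^sub>0 \<Longrightarrow> ln (1 + B) + \<mu> * ln (1 - B) \<le> 0"
    and "B\<^sub>0 < B \<Longrightarrow> B < 0 \<Longrightarrow> 0 \<le> ln (1 + B) + \<mu> * ln (1 - B)"
    and "0 < B \<Longrightarrow> ln (1 + B) + \<mu> * ln (1 - B) \<le> 0"
proof -
  define g where "g x = ln (1 + x) + \<mu> * ln (1 - x)" for x
  have "g B\<^sub>0 = ln ((1 + B\<^sub>0) * (1 - B\<^sub>0) powr \<mu>)"
    using assms(2,3) by (simp add: g_def ln_mult_pos ln_powr)
  then have g0: "g B\<^sub>0 = 0" "g 0 = 0"
    by (simp_all add: assms(4) g_def)
  have concave: "(1 - t) * g x + t * g y \<le> g ((1 - t) * x + t * y)"
    if "0 \<le> t" "t \<le> 1" "\<bar>x\<bar> < 1" "\<bar>y\<bar> < 1" for t x y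
  proof -
    have "(1 - t) * ln (1 + x) + t * ln (1 + y) \<le> ln ((1 - t) * (1 + x) + t * (1 + y))"
      using concave_onD[OF ln_concave, of t "1 + x" "1 + y"] that by simp
    moreover have "(1 - t) * ln (1 - x) + t * ln (1 - y) \<le> ln ((1 - t) * (1 - x) + t * (1 - y))"
      using concave_onD[OF ln_concave, of t "1 - x" "1 - y"] that by simp
    then have "\<mu> * ((1 - t) * ln (1 - x) + t * ln (1 - y)) \<le> \<mu> * ln ((1 - t) * (1 - x) + t * (1 - y))"
      using assms by (intro mult_left_mono) auto
    ultimately show ?thesis
      by (simp add: g_def algebra_simps)
  qed
  show "ln (1 + B) + \<mu> * ln (1 - B) \<le> 0" if "B \<le> B\<^sub>0"
  proof -
    define t where "t = B\<^sub>0 / B"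
    have t: "0 < t" "t \<le> 1" "t * B = B\<^sub>0" using that assms by (auto simp: t_def field_simps)
    then have "t * g B \<le> 0"
      using concave[of t 0 B] assms g0 by simp
    then show ?thesis using t by (simp add: g_def mult_le_0_iff)
  qed
  show "0 \<le> ln (1 + B) + \<mu> * ln (1 - B)" if "B\<^sub>0 < B" "B < 0"
  proof -
    define t where "t = B / B\<^sub>0"
    have t: "0 < t" "t \<le> 1" "t * B\<^sub>0 = B" using that assms by (auto simp: t_def field_simps)
    then show ?thesis
      using concave[of t 0 B\<^sub>0] assms g0 by (simp add: g_def)
  qed
  show "ln (1 + B) + \<mu> * ln (1 - B) \<le> 0" if "0 < B"
  proof -
    define t where "t = - B\<^sub>0 / (B - B\<^sub>0)"
    have t: "0 < t" "t \<le> 1" "(1 - t) * B\<^sub>0 + t * B = 0"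
      using that assms by (auto simp: t_def field_simps)
    then have "t * g B \<le> 0"
      using concave[of t B\<^sub>0 B] assms g0 by simp
    then show ?thesis using t by (simp add: g_def mult_le_0_iff)
  qed
qed

text \<open>Each case of \<open>eta_condition\<close> states only the stronger of the two bounds;
  the sign of \<open>m * scaled_ln B 1 + M * scaled_ln B (-1)\<close> tells which one implies the
  other.\<close>

lemma eta_condition_iff:
  fixes A B B\<^sub>0 \<mu> \<eta> :: real
  assumes "\<bar>B\<bar> < 1" "-1 < B\<^sub>0" "B\<^sub>0 < 0" "(1 + B\<^sub>0) * (1 - B\<^sub>0) powr \<mu> = 1"
    and \<mu>: "\<mu> = (cosh 1 - 1) / (1 - cos 1)" and "B < A"
  shows "eta_condition B\<^sub>0 A B \<eta> \<longleftrightarrow>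
    (A - B) * scaled_ln B 1 \<le> \<eta> * (cosh 1 - 1) \<and> (A - B) * (- scaled_ln B (-1)) \<le> \<eta> * (1 - cos 1)"
    (is "_ \<longleftrightarrow> ?R \<and> ?L")
proof -
  define M m where "M = cosh (1::real) - 1" and "m = 1 - cos (1::real)"
  have M: "0 < m" "m \<le> M" using cosh_cos_1_bounds by (auto simp: M_def m_def)
  have \<mu>': "0 < \<mu>" "\<mu> * m = M" using M by (auto simp: \<mu> M_def m_def)
  note root = root_condition[OF assms(1-4) \<mu>'(1)]
  \<comment> \<open>The division by \<open>B\<close> reverses the signs from
    \<open>root_condition\<close> when \<open>B\<close> is negative.\<close>
  have root_scaled: "m * scaled_ln B 1 + M * scaled_ln B (-1) = m * (ln (1 + B) + \<mu> * ln (1 - B)) / B"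
    if "B \<noteq> 0" using that by (simp add: scaled_ln_def field_simps flip: \<mu>'(2))
  have R_imp_L: ?L if ?R and G: "0 \<le> m * scaled_ln B 1 + M * scaled_ln B (-1)"
  proof -
    have "M * ((A - B) * (- scaled_ln B (-1))) = (A - B) * (- (M * scaled_ln B (-1)))" by simp
    also have "\<dots> \<le> (A - B) * (m * scaled_ln B 1)"
      using G \<open>B < A\<close> by (intro mult_left_mono) auto
    also have "\<dots> = m * ((A - B) * scaled_ln B 1)" by simp
    also have "\<dots> \<le> m * (\<eta> * M)"
      using \<open>?R\<close> M by (intro mult_left_mono) (auto simp: M_def)
    also have "\<dots> = M * (\<eta> * m)" by simp
    finally show ?L
      using M unfolding m_def[symmetric] by (elim mult_left_le_imp_le) linarith
  qed
  have L_imp_R: ?R if ?L and G: "m * scaled_ln B 1 + M * scaled_ln B (-1) \<le> 0"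
  proof -
    have "m * ((A - B) * scaled_ln B 1) = (A - B) * (m * scaled_ln B 1)" by simp
    also have "\<dots> \<le> (A - B) * (M * - scaled_ln B (-1))"
      using G \<open>B < A\<close> by (intro mult_left_mono) auto
    also have "\<dots> = M * ((A - B) * - scaled_ln B (-1))" by simp
    also have "\<dots> \<le> M * (\<eta> * m)"
      using \<open>?L\<close> M by (intro mult_left_mono) (auto simp: m_def)
    also have "\<dots> = m * (\<eta> * M)" by simp
    finally show ?R
      using M unfolding M_def[symmetric] by (elim mult_left_le_imp_le)
  qed
  consider "B \<le> B\<^sub>0" | "B\<^sub>0 < B" "B < 0" | "B = 0" | "0 < B" by linarith
  then show ?thesis
  proof cases
    case 1
    then have "B < 0" using assms by simp
    then have "eta_condition B\<^sub>0 A B \<eta> \<longleftrightarrow> ?R"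
      using 1 assms by (simp add: eta_condition_def scaled_ln_def field_simps)
    moreover have "0 \<le> m * scaled_ln B 1 + M * scaled_ln B (-1)"
      using root(1) 1 M \<open>B < 0\<close> by (simp add: root_scaled zero_le_divide_iff mult_le_0_iff)
    ultimately show ?thesis using R_imp_L by blast
  next
    case 2
    then have "eta_condition B\<^sub>0 A B \<eta> \<longleftrightarrow> ?L"
      using assms by (simp add: eta_condition_def scaled_ln_def field_simps)
    moreover have "m * scaled_ln B 1 + M * scaled_ln B (-1) \<le> 0"
      using root(2) 2 M by (simp add: root_scaled divide_le_0_iff zero_le_mult_iff)
    ultimately show ?thesis using L_imp_R by blast
  next
    case 3
    \<comment> \<open>The half-angle formula turns the squared cosecant into
      \<open>2 / (1 - cos 1)\<close>.\<close>
    have "1 - cos 1 = 2 * (sin (1 / 2 :: real))\<^sup>2"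
      using cos_double_sin[of "1 / 2 :: real"] by simp
    moreover from this have "0 < (sin (1 / 2 :: real))\<^sup>2"
      using M by (simp add: m_def)
    ultimately have "eta_condition B\<^sub>0 A B \<eta> \<longleftrightarrow> ?L"
      using 3 assms by (simp add: eta_condition_def scaled_ln_def power_divide divide_le_eq mult_ac)
    moreover have "m * scaled_ln B 1 + M * scaled_ln B (-1) \<le> 0"
      using 3 M by (simp add: scaled_ln_def)
    ultimately show ?thesis using L_imp_R by blast
  next
    case 4
    then have "eta_condition B\<^sub>0 A B \<eta> \<longleftrightarrow> ?L"
      using assms by (simp add: eta_condition_def scaled_ln_def field_simps)
    moreover have "m * scaled_ln B 1 + M * scaled_ln B (-1) \<le> 0"
      using root(3) 4 M by (simp add: root_scaled divide_le_0_iff mult_le_0_iff)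
    ultimately show ?thesis using L_imp_R by blast
  qed
qed

theorem theorem3p5:
  fixes A B B\<^sub>0 \<mu> :: real
  assumes "-1 < B" and "B < A" and "A \<le> 1"
    and "\<mu> = (cosh 1 - 1) / (1 - cos 1)"
    and "-1 < B\<^sub>0" and "B\<^sub>0 < 0" and "(1 + B\<^sub>0) * (1 - B\<^sub>0) powr \<mu> = 1"
  shows "(\<forall>\<eta>. \<eta> \<noteq> 0 \<and> eta_condition B\<^sub>0 A B \<eta> \<longrightarrow> subordination_implication A B \<eta>) \<and>
    (\<exists>\<eta>\<^sub>0. (\<forall>\<eta>. eta_condition B\<^sub>0 A B \<eta> \<longleftrightarrow> \<eta>\<^sub>0 \<le> \<eta>) \<and>
      (\<forall>c<\<eta>\<^sub>0. \<not> (\<forall>\<eta>\<ge>c. \<eta> \<noteq> 0 \<longrightarrow> subordination_implication A B \<eta>)))"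
proof -
  \<comment> \<open>The values of \<open>\<eta>\<close> at which the extremal function reaches
    \<open>cosh 1\<close> at the point 1 and \<open>cos 1\<close> at the point -1,
    respectively.\<close>
  define r l where "r = (A - B) * scaled_ln B 1 / (cosh 1 - 1)"
    and "l = (A - B) * (- scaled_ln B (-1)) / (1 - cos 1)"
  have B: "\<bar>B\<bar> < 1" using assms by simp
  have M: "0 < cosh (1::real) - 1" "0 < 1 - cos (1::real)" using cosh_cos_1_bounds by auto
  have iff: "eta_condition B\<^sub>0 A B \<eta> \<longleftrightarrow> max r l \<le> \<eta>" for \<eta>
    using eta_condition_iff[OF B assms(5-7,4,2), of \<eta>] M
    by (simp only: r_def l_def max.bounded_iff pos_divide_le_eq)
  have pos: "0 < max r l"
    using scaled_ln_sign[OF B] M assms(2) by (simp add: r_def less_max_iff_disj)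
  have "subordination_implication A B \<eta>" if "max r l \<le> \<eta>" for \<eta>
  proof (rule subordination_implicationI[OF B assms(2)])
    show "0 < \<eta>" using pos that by linarith
    then show "(A - B) / \<eta> * scaled_ln B 1 \<le> cosh 1 - 1"
      "cos 1 - 1 \<le> (A - B) / \<eta> * scaled_ln B (-1)"
      using that M by (simp_all add: r_def l_def field_simps)
  qed
  moreover have "\<exists>\<eta>\<ge>c. \<eta> \<noteq> 0 \<and> \<not> subordination_implication A B \<eta>" if "c < max r l" for c
  proof -
    \<comment> \<open>The counterexample needs \<open>\<eta>\<close> positive, whereas
      \<open>c\<close> may be negative.\<close>
    have "max c 0 < max r l" using that pos by simp
    then obtain \<eta> where \<eta>: "max c 0 < \<eta>" "\<eta> < max r l"
      using dense by blast
    then have "0 < \<eta>" by simp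
    have "cosh 1 - 1 < (A - B) / \<eta> * scaled_ln B 1 \<or> (A - B) / \<eta> * scaled_ln B (-1) < cos 1 - 1"
      using \<eta>(2) \<open>0 < \<eta>\<close> M by (auto simp: r_def l_def less_max_iff_disj field_simps)
    then have "\<not> subordination_implication A B \<eta>"
      by (rule not_subordination_implicationI[OF B \<open>0 < \<eta>\<close>])
    then show ?thesis using \<eta>(1) \<open>0 < \<eta>\<close> by (intro exI[of _ \<eta>]) auto
  qed
  ultimately show ?thesis
    unfolding iff by (intro conjI exI[of _ "max r l"]) blast+
qed

end
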